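(* Let $\mathcal{M}$ be a regular matroid of rank $r>0$ on $n$ elements and let $M\in\mathbb{Z}^{r\times n}$ be any full-rank weakly unimodular matrix representing $\mathcal{M}$. Then: (i) $\mathcal{P}_M$ is centrally symmetric; (ii) $\dim(\mathcal{P}_M)=\mathrm{rk}(\mathcal{M})$; (iii) $\mathcal{P}_M$ is reflexive; (iv) $\mathcal{P}_M$ is terminal, i.e., the only points of $\mathcal{P}_M$ with integer coordinates are its vertices and the origin; (v) the number of vertices of $\mathcal{P}_M$ is twice the number of atoms (rank-one flats) of the lattice of flats of $\mathcal{M}$; in particular, if $\mathcal{M}$ is simple, every antipodal pair of vertices of $\mathcal{P}_M$ corresponds to an element of the ground set of $\mathcal{M}$ (namely the vertices are exactly the $2n$ columns $\pm M\mathbf{e}_i$ of $[M\mid -M]$).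
   Context: A matrix $M\in\mathbb{Z}^{r\times n}$ with $0<r\le n$ is full-rank weakly unimodular if it has rank $r$ and every $r\times r$ minor lies in $\{0,\pm1\}$. $M$ represents the matroid $\mathcal{M}$ if the matroid on $[n]$ whose independent sets are the sets of linearly independent columns of $M$ is isomorphic to $\mathcal{M}$; a matroid of positive rank is regular if it has such a representation. $\mathcal{P}_M\subseteq\mathbb{R}^r$ is the convex hull of the columns of $[M\mid -M]$ (this is the generalized symmetric edge polytope of $\mathcal{M}$, well defined up to unimodular equivalence fixing the origin). A full-dimensional lattice polytope $P$ with the origin in its interior is reflexive if its polar $P^\Delta=\{\mathbf{u}:\mathbf{u}\cdot\mathbf{x}\le 1\ \forall \mathbf{x}\in P\}$ is a lattice polytope. *)

theory Defs
  imports "HOL-Analysis.Analysis"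
begin

locale matroid =
  fixes E :: "'a set" and I :: "'a set set"
  assumes finite_ground: "finite E"
    and indep_subset_ground: "X \<in> I \<Longrightarrow> X \<subseteq> E"
    and indep_empty: "{} \<in> I"
    and indep_mono: "X \<in> I \<Longrightarrow> Y \<subseteq> X \<Longrightarrow> Y \<in> I"
    and indep_exchange: "X \<in> I \<Longrightarrow> Y \<in> I \<Longrightarrow> card X < card Y \<Longrightarrow> \<exists>y\<in>Y - X. insert y X \<in> I"

definition matroid_rank :: "'a set set \<Rightarrow> 'a set \<Rightarrow> nat" where
  "matroid_rank I X = Max (card ` {Y \<in> I. Y \<subseteq> X})"

definition flat :: "'a set \<Rightarrow> 'a set set \<Rightarrow> 'a set \<Rightarrow> bool" where
  "flat E I F \<longleftrightarrow> F \<subseteq> E \<and> (\<forall>x\<in>E - F. matroid_rank I F < matroid_rank I (insert x F))"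

definition flat_atoms :: "'a set \<Rightarrow> 'a set set \<Rightarrow> 'a set set" where
  "flat_atoms E I = {F. flat E I F \<and> matroid_rank I F = 1}"

definition matroid_loop :: "'a set \<Rightarrow> 'a set set \<Rightarrow> 'a \<Rightarrow> bool" where
  "matroid_loop E I x \<longleftrightarrow> x \<in> E \<and> {x} \<notin> I"

definition matroid_parallel :: "'a set \<Rightarrow> 'a set set \<Rightarrow> 'a \<Rightarrow> 'a \<Rightarrow> bool" where
  "matroid_parallel E I x y \<longleftrightarrow>
     x \<in> E \<and> y \<in> E \<and> x \<noteq> y \<and> {x} \<in> I \<and> {y} \<in> I \<and> {x, y} \<notin> I"

definition simple_matroid :: "'a set \<Rightarrow> 'a set set \<Rightarrow> bool" where
  "simple_matroid E I \<longleftrightarrow> (\<forall>x. \<not> matroid_loop E I x) \<and> (\<forall>x y. \<not> matroid_parallel E I x y)"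

definition matroid_isomorphism ::
    "('a \<Rightarrow> 'b) \<Rightarrow> 'a set \<Rightarrow> 'a set set \<Rightarrow> 'b set \<Rightarrow> 'b set set \<Rightarrow> bool" where
  "matroid_isomorphism \<phi> E I E' I' \<longleftrightarrow>
     bij_betw \<phi> E E' \<and> (\<forall>X\<subseteq>E. X \<in> I \<longleftrightarrow> \<phi> ` X \<in> I')"

abbreviation real_matrix :: "int ^ 'n::finite ^ 'r::finite \<Rightarrow> real ^ 'n ^ 'r" where
  "real_matrix M \<equiv> map_matrix real_of_int M"

text \<open>
  A maximal minor is obtained by listing \<open>r\<close> distinct columns. The index type carries no order;
  reordering the columns changes the minor only by a sign, which membership in \<open>{-1, 0, 1}\<close>
  does not see.
\<close>

definition full_rank_weakly_unimodular :: "int ^ 'n::finite ^ 'r::finite \<Rightarrow> bool" where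
  "full_rank_weakly_unimodular M \<longleftrightarrow>
     CARD('r) \<le> CARD('n) \<and>
     rank (real_matrix M) = CARD('r) \<and>
     (\<forall>f :: 'r \<Rightarrow> 'n. inj f \<longrightarrow> det (\<chi> i j. M $ i $ f j) \<in> {-1, 0, 1})"

text \<open>
  Independence is that of the family of columns indexed by \<open>S\<close>, so two equal columns with
  different indices are dependent.
\<close>

definition column_indep :: "int ^ 'n::finite ^ 'r::finite \<Rightarrow> 'n set set" where
  "column_indep M =
     {S. inj_on (\<lambda>j. column j (real_matrix M)) S \<and>
         independent ((\<lambda>j. column j (real_matrix M)) ` S)}"

definition represents :: "int ^ 'n::finite ^ 'r::finite \<Rightarrow> 'a set \<Rightarrow> 'a set set \<Rightarrow> bool" where
  "represents M E I \<longleftrightarrow> (\<exists>\<phi>. matroid_isomorphism \<phi> E I UNIV (column_indep M))"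

text \<open>
  The type arguments give the format of the representing matrix. They are determined by the
  matroid up to a bijection of index types: a full-rank weakly unimodular \<open>r \<times> n\<close> matrix can only
  represent a matroid of rank \<open>r\<close> on \<open>n\<close> elements.
\<close>

definition regular_matroid ::
    "'r::finite itself \<Rightarrow> 'n::finite itself \<Rightarrow> 'a set \<Rightarrow> 'a set set \<Rightarrow> bool" where
  "regular_matroid tr tn E I \<longleftrightarrow>
     matroid E I \<and> 0 < matroid_rank I E \<and>
     (\<exists>M :: int ^ 'n ^ 'r. full_rank_weakly_unimodular M \<and> represents M E I)"

definition integer_points :: "(real ^ 'r::finite) set" where
  "integer_points = {x. \<forall>i. x $ i \<in> \<int>}"

definition lattice_polytope :: "(real ^ 'r::finite) set \<Rightarrow> bool" where
  "lattice_polytope P \<longleftrightarrow> (\<exists>V. finite V \<and> V \<subseteq> integer_points \<and> P = convex hull V)"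

definition polar_dual :: "(real ^ 'r::finite) set \<Rightarrow> (real ^ 'r) set" where
  "polar_dual P = {u. \<forall>x\<in>P. u \<bullet> x \<le> 1}"

definition reflexive_polytope :: "(real ^ 'r::finite) set \<Rightarrow> bool" where
  "reflexive_polytope P \<longleftrightarrow>
     lattice_polytope P \<and> aff_dim P = int CARD('r) \<and> 0 \<in> interior P \<and>
     lattice_polytope (polar_dual P)"

definition centrally_symmetric :: "(real ^ 'r::finite) set \<Rightarrow> bool" where
  "centrally_symmetric P \<longleftrightarrow> uminus ` P = P"

definition polytope_vertices :: "(real ^ 'r::finite) set \<Rightarrow> (real ^ 'r) set" where
  "polytope_vertices P = {v. v extreme_point_of P}"

definition terminal_polytope :: "(real ^ 'r::finite) set \<Rightarrow> bool" where
  "terminal_polytope P \<longleftrightarrow> P \<inter> integer_points = insert 0 (polytope_vertices P)"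

definition sym_matrix :: "int ^ 'n::finite ^ 'r::finite \<Rightarrow> int ^ ('n + 'n) ^ 'r" where
  "sym_matrix M = (\<chi> i j. case j of Inl k \<Rightarrow> M $ i $ k | Inr k \<Rightarrow> - (M $ i $ k))"

definition sym_edge_polytope :: "int ^ 'n::finite ^ 'r::finite \<Rightarrow> (real ^ 'r) set" where
  "sym_edge_polytope M = convex hull (columns (real_matrix (sym_matrix M)))"

end

theory Submission
  imports Defs
begin

text \<open>
  Let \<open>S\<close> be the set of columns of \<open>[M | -M]\<close>. Any basis contained in \<open>S\<close> has determinant \<open>\<plusminus>1\<close>,
  so by Cramer's rule integer vectors have integer coordinates in it. A point of the convex hull of
  \<open>W \<subseteq> S\<close> is a nonnegative combination of linearly independent elements of \<open>W\<close> with coefficient sum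
  at most \<open>1\<close>; for a nonzero integer point the coefficients are positive integers, so the point
  lies in \<open>W\<close>. For \<open>W = S\<close> this is terminality; for \<open>W\<close> the set of vertices it shows that every
  nonzero column is a vertex. At a vertex of the polar the tight constraints contain a basis from
  \<open>S\<close>, so the vertex solves a unimodular system with right-hand side \<open>1\<close> and is integral. Finally,
  parallel columns are integer multiples of each other and hence agree up to sign, which identifies
  antipodal pairs of vertices with atoms.
\<close>

section \<open>Integral linear algebra and general convexity\<close>

lemma det_in_Ints:
  fixes A :: "real ^ 'r::finite ^ 'r"
  assumes "\<And>i j. A $ i $ j \<in> \<int>"
  shows "det A \<in> \<int>"
  unfolding det_def using assms by (auto intro!: Ints_sum Ints_mult Ints_prod)

text \<open>Cramer's rule writes each coordinate of \<open>x\<close> as an integer determinant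
  divided by a determinant that is a unit.\<close>

lemma integral_solution_of_unimodular:
  fixes A :: "real ^ 'r::finite ^ 'r"
  assumes int: "\<And>i j. A $ i $ j \<in> \<int>" and det: "det A \<in> {-1, 1}"
    and rhs: "A *v x \<in> integer_points"
  shows "x \<in> integer_points"
proof -
  have x: "x = (\<chi> k. det (\<chi> i j. if j = k then (A *v x) $ i else A $ i $ j) / det A)"
    using cramer[of A x "A *v x"] det by auto
  have "x $ k \<in> \<int>" for k
  proof -
    have "det (\<chi> i j. if j = k then (A *v x) $ i else A $ i $ j) \<in> \<int>"
      by (rule det_in_Ints) (use int rhs in \<open>auto simp: integer_points_def\<close>)
    moreover have "x $ k = det (\<chi> i j. if j = k then (A *v x) $ i else A $ i $ j) / det A"
      by (subst x) simp
    ultimately show ?thesis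
      using det by auto
  qed
  then show ?thesis
    by (simp add: integer_points_def)
qed

text \<open>A linear version of Caratheodory's theorem: letting the coefficient sum drop below
  \<open>1\<close> amounts to adjoining the origin, so that linear and not merely affine
  independence can be reached. In a representation on as few vectors as possible, a linear
  dependence would allow one more coefficient to be cancelled.\<close>

lemma convex_hull_combination_of_independent:
  fixes W :: "'v::real_vector set"
  assumes "finite W" "x \<in> convex hull W"
  obtains T c where "T \<subseteq> W" "independent T" "\<And>t. t \<in> T \<Longrightarrow> 0 < c t" "sum c T \<le> (1::real)"
    "x = (\<Sum>t\<in>T. c t *\<^sub>R t)"
proof -
  define R where "R T \<longleftrightarrow> T \<subseteq> W \<and>
    (\<exists>c. (\<forall>t\<in>T. 0 \<le> c t) \<and> sum c T \<le> (1::real) \<and> x = (\<Sum>t\<in>T. c t *\<^sub>R t))" for T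
  have "R W"
    using assms by (force simp: R_def convex_hull_finite)
  then obtain T where T: "R T" and min: "\<And>T'. R T' \<Longrightarrow> card T \<le> card T'"
    using ex_has_least_nat[of R W card] by blast
  then obtain c where TW: "T \<subseteq> W" and c: "\<And>t. t \<in> T \<Longrightarrow> 0 \<le> c t" "sum c T \<le> 1"
      "x = (\<Sum>t\<in>T. c t *\<^sub>R t)"
    unfolding R_def by blast
  have fin: "finite T"
    using TW assms(1) finite_subset by blast
  \<comment> \<open>Minimality of \<open>T\<close> enters in this form: no admissible representation
    on \<open>T\<close> has a zero coefficient.\<close>
  have reduce: False
    if d: "\<And>t. t \<in> T \<Longrightarrow> 0 \<le> d t" "sum d T \<le> 1" "x = (\<Sum>t\<in>T. d t *\<^sub>R t)"
      and s: "s \<in> T" "d s = 0" for d s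
  proof -
    have "sum d (T - {s}) \<le> 1" "x = (\<Sum>t\<in>T - {s}. d t *\<^sub>R t)"
      using d s fin by (simp_all add: sum_diff1)
    then have "R (T - {s})"
      unfolding R_def using TW d(1) by blast
    then show False
      using min s fin by (metis card_Diff1_less leD)
  qed
  have pos: "0 < c t" if "t \<in> T" for t
    using reduce[of c t] c that by fastforce
  have "independent T"
  proof
    assume "dependent T"
    then obtain m0 where m0: "(\<Sum>t\<in>T. m0 t *\<^sub>R t) = 0" "\<exists>t\<in>T. m0 t \<noteq> 0"
      using fin by (auto simp: dependent_finite)
    \<comment> \<open>The sign is chosen so that subtracting a positive multiple of \<open>m\<close>
      cannot raise the coefficient sum.\<close>
    define m where "m = (if sum m0 T \<ge> 0 then m0 else (\<lambda>t. - m0 t))"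
    have m: "(\<Sum>t\<in>T. m t *\<^sub>R t) = 0" "\<exists>t\<in>T. m t \<noteq> 0" "0 \<le> sum m T"
      using m0 by (auto simp: m_def sum_negf)
    define Q where "Q = {t \<in> T. 0 < m t}"
    have "Q \<noteq> {}"
    proof
      assume "Q = {}"
      then have le: "\<And>t. t \<in> T \<Longrightarrow> 0 \<le> - m t"
        by (force simp: Q_def)
      moreover have "(\<Sum>t\<in>T. - m t) = 0"
        using m(3) sum_nonneg[of T "\<lambda>t. - m t"] le by (simp add: sum_negf)
      ultimately show False
        using m(2) fin sum_nonneg_eq_0_iff[of T "\<lambda>t. - m t"] by auto
    qed
    moreover have finQ: "finite Q"
      using fin by (simp add: Q_def)
    \<comment> \<open>The ratio test of the simplex method: \<open>c s / m s\<close> is the largest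
      step along \<open>m\<close> that keeps all coefficients nonnegative, and it brings the one of
      \<open>s\<close> to zero.\<close>
    moreover define s where "s = arg_min_on (\<lambda>t. c t / m t) Q"
    ultimately have s: "s \<in> Q" and smin: "\<And>t. t \<in> Q \<Longrightarrow> c s / m s \<le> c t / m t"
      using arg_min_if_finite(1)[of Q] arg_min_least[of Q _ "\<lambda>t. c t / m t"] by auto
    define \<theta> where "\<theta> = c s / m s"
    have \<theta>: "0 < \<theta>"
      using s pos by (simp add: \<theta>_def Q_def)
    show False
    proof (rule reduce)
      show "s \<in> T" "c s - \<theta> * m s = 0"
        using s by (auto simp: Q_def \<theta>_def)
      show "0 \<le> c t - \<theta> * m t" if "t \<in> T" for t
      proof (cases "0 < m t")
        case True
        then show ?thesis
          using smin[of t] that by (simp add: Q_def \<theta>_def pos_le_divide_eq)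
      next
        case False
        then have "\<theta> * m t \<le> 0"
          using \<theta> by (simp add: mult_nonneg_nonpos)
        then show ?thesis
          using c(1)[OF that] by linarith
      qed
      have "0 \<le> \<theta> * sum m T"
        using \<theta> m(3) by simp
      then show "(\<Sum>t\<in>T. c t - \<theta> * m t) \<le> 1"
        using c(2) by (simp add: sum_subtractf sum_distrib_left)
      have "(\<Sum>t\<in>T. (\<theta> * m t) *\<^sub>R t) = 0"
        using m(1) by (metis (no_types, lifting) scaleR_right.sum scaleR_scaleR scaleR_zero_right sum.cong)
      then show "x = (\<Sum>t\<in>T. (c t - \<theta> * m t) *\<^sub>R t)"
        using c(3) by (simp add: scaleR_left_diff_distrib sum_subtractf)
    qed
  qed
  then show thesis
    using that TW pos c by blast
qed

text \<open>If the tight constraints did not span, \<open>u\<close> could move both ways along some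
  nonzero \<open>d\<close> orthogonal to all of them: tight constraints stay tight and slack ones
  survive a small step. Then \<open>u\<close> would be the midpoint of two other points of the
  polar.\<close>

lemma extreme_point_of_polar_tight_span:
  fixes S :: "'v::euclidean_space set"
  assumes fin: "finite S" and ext: "u extreme_point_of {u. \<forall>s\<in>S. u \<bullet> s \<le> 1}"
  shows "span {s \<in> S. u \<bullet> s = 1} = UNIV"
proof (rule ccontr)
  assume "span {s \<in> S. u \<bullet> s = 1} \<noteq> UNIV"
  then obtain d where "d \<noteq> 0" and orth: "\<forall>x\<in>span {s \<in> S. u \<bullet> s = 1}. d \<bullet> x = 0"
    using span_not_UNIV_orthogonal by blast
  then have d: "d \<noteq> 0" "\<And>s. s \<in> S \<Longrightarrow> u \<bullet> s = 1 \<Longrightarrow> d \<bullet> s = 0"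
    by (auto intro: span_base)
  have u: "u \<bullet> s \<le> 1" if "s \<in> S" for s
    using ext that by (auto simp: extreme_point_of_def)
  have "\<forall>\<^sub>F e in at_right 0. u \<bullet> s + e * \<bar>d \<bullet> s\<bar> \<le> 1" if s: "s \<in> S" for s
  proof (cases "u \<bullet> s = 1")
    case True
    then show ?thesis
      using d s by simp
  next
    case False
    have "((\<lambda>e. u \<bullet> s + e * \<bar>d \<bullet> s\<bar>) \<longlongrightarrow> u \<bullet> s + 0 * \<bar>d \<bullet> s\<bar>) (at_right 0)"
      by (intro tendsto_intros)
    moreover have "u \<bullet> s + 0 * \<bar>d \<bullet> s\<bar> < 1"
      using False u[OF s] by simp
    ultimately have "\<forall>\<^sub>F e in at_right 0. u \<bullet> s + e * \<bar>d \<bullet> s\<bar> < 1"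
      by (rule order_tendstoD(2))
    then show ?thesis
      by (rule eventually_mono) simp
  qed
  then have "\<forall>\<^sub>F e in at_right 0. \<forall>s\<in>S. u \<bullet> s + e * \<bar>d \<bullet> s\<bar> \<le> 1"
    using fin by (simp add: eventually_ball_finite)
  then have "\<forall>\<^sub>F e in at_right 0. 0 < e \<and> (\<forall>s\<in>S. u \<bullet> s + e * \<bar>d \<bullet> s\<bar> \<le> 1)"
    by (intro eventually_conj eventually_at_right_less)
  \<comment> \<open>Finiteness of \<open>S\<close> makes one step length serve all
    constraints.\<close>
  then obtain e :: real where e: "0 < e" "\<And>s. s \<in> S \<Longrightarrow> u \<bullet> s + e * \<bar>d \<bullet> s\<bar> \<le> 1"
    using eventually_happens'[OF trivial_limit_at_right_real] by blast
  \<comment> \<open>The bound with the absolute value covers the steps along \<open>d\<close> and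
    \<open>- d\<close> alike.\<close>
  have bnd: "e * (d \<bullet> s) \<le> e * \<bar>d \<bullet> s\<bar>" "- (e * (d \<bullet> s)) \<le> e * \<bar>d \<bullet> s\<bar>" for s
    using e(1) by (auto simp: abs_if)
  have "(u - e *\<^sub>R d) \<bullet> s \<le> 1" "(u + e *\<^sub>R d) \<bullet> s \<le> 1" if "s \<in> S" for s
    using e(2)[OF that] bnd[of s] by (simp_all add: inner_diff_left inner_add_left)
  then have polar: "u - e *\<^sub>R d \<in> {u. \<forall>s\<in>S. u \<bullet> s \<le> 1}" "u + e *\<^sub>R d \<in> {u. \<forall>s\<in>S. u \<bullet> s \<le> 1}"
    by auto
  have "u + e *\<^sub>R d - (u - e *\<^sub>R d) = (2 * e) *\<^sub>R d"
    by (simp add: scaleR_2[symmetric])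
  then have "u - e *\<^sub>R d \<noteq> u + e *\<^sub>R d"
    using d(1) e(1) by force
  moreover have "midpoint (u - e *\<^sub>R d) (u + e *\<^sub>R d) = u"
    by (simp add: midpoint_def scaleR_2[symmetric])
  ultimately have "u \<in> open_segment (u - e *\<^sub>R d) (u + e *\<^sub>R d)"
    using midpoint_in_open_segment[of "u - e *\<^sub>R d" "u + e *\<^sub>R d"] by simp
  then show False
    using ext polar unfolding extreme_point_of_def by blast
qed

section \<open>Symmetric unimodular systems of vectors\<close>

locale unimodular_system =
  fixes S :: "(real ^ 'r::finite) set"
  assumes finite: "finite S"
    and integral: "S \<subseteq> integer_points"
    and uminus_closed: "s \<in> S \<Longrightarrow> - s \<in> S"
    and spanning: "span S = UNIV"
    and det: "range g \<subseteq> S \<Longrightarrow> det (\<chi> i. g i) \<in> {-1, 0, 1}"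
begin

text \<open>The basis vectors become the rows of a square matrix. Independence makes its determinant
  nonzero, which leaves only the values \<open>1\<close> and \<open>-1\<close>.\<close>

lemma unimodular_basis:
  assumes "B \<subseteq> S" "independent B" "span B = UNIV"
  obtains g :: "'r \<Rightarrow> real ^ 'r" where "bij_betw g UNIV B"
    "\<And>i j. (\<chi> i. g i) $ i $ j \<in> \<int>" "det (\<chi> i. g i) \<in> {-1, 1}"
proof -
  have card: "card B = CARD('r)"
    using assms(2,3) by (metis dim_eq_card_independent dim_span dim_vec_eq vec_dim_card)
  have "finite B"
    using assms(1) finite finite_subset by blast
  then obtain g :: "'r \<Rightarrow> real ^ 'r" where g: "bij_betw g UNIV B"
    using card finite_same_card_bij[of "UNIV :: 'r set" B] by auto
  then have range: "range g = B"
    by (simp add: bij_betw_def)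
  have "rows (\<chi> i. g i) = B"
    using range by (auto simp: rows_def row_def vec_lambda_eta)
  then have "rank (\<chi> i. g i) = CARD('r)"
    using card assms(2) by (simp add: row_rank_def dim_eq_card_independent)
  then have "det (\<chi> i. g i) \<noteq> 0"
    by (simp add: det_eq_0_rank)
  moreover have "det (\<chi> i. g i) \<in> {-1, 0, 1}"
    using det[of g] assms(1) range by simp
  moreover have "(\<chi> i. g i) $ i $ j \<in> \<int>" for i j
    using integral assms(1) range by (auto simp: integer_points_def)
  ultimately show thesis
    using that g by auto
qed

text \<open>\<open>T\<close> extends within \<open>S\<close> to a basis of the whole space. Padded
  with zeros outside \<open>T\<close>, the coefficients solve a unimodular system with integral
  right-hand side.\<close>

lemma coordinates_integral:
  assumes T: "T \<subseteq> S" "independent T" and x: "(\<Sum>t\<in>T. c t *\<^sub>R t) \<in> integer_points"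
    and t: "t \<in> T"
  shows "c t \<in> \<int>"
proof -
  obtain B where B: "T \<subseteq> B" "B \<subseteq> S" "independent B" "S \<subseteq> span B"
    using maximal_independent_subset_extend T by metis
  then have "span B = UNIV"
    using spanning by (metis span_mono span_span top.extremum_uniqueI)
  then obtain g :: "'r \<Rightarrow> real ^ 'r" where g: "bij_betw g UNIV B"
    "\<And>i j. (\<chi> i. g i) $ i $ j \<in> \<int>" "det (\<chi> i. g i) \<in> {-1, 1}"
    using unimodular_basis B by metis
  define c' where "c' b = (if b \<in> T then c b else 0)" for b
  define x where "x = (\<chi> i. c' (g i))"
  \<comment> \<open>Since the basis vectors are rows, it is the transpose that sends coordinates to
    the combination.\<close>
  have "transpose (\<chi> i. g i) *v x = (\<Sum>i\<in>UNIV. c' (g i) *\<^sub>R g i)"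
    by (simp add: matrix_mult_sum x_def scalar_mult_eq_scaleR row_def vec_lambda_eta)
  also have "\<dots> = (\<Sum>b\<in>B. c' b *\<^sub>R b)"
    by (rule sum.reindex_bij_betw[OF g(1)])
  also have "\<dots> = (\<Sum>t\<in>T. c t *\<^sub>R t)"
    using B(1,2) finite finite_subset
    by (intro sum.mono_neutral_cong_right) (auto simp: c'_def)
  finally have "transpose (\<chi> i. g i) *v x \<in> integer_points"
    using assms(3) by simp
  moreover have "transpose (\<chi> i. g i) $ i $ j \<in> \<int>" for i j
    using g(2) by (simp add: transpose_def)
  moreover have "det (transpose (\<chi> i. g i)) \<in> {-1, 1}"
    using g(3) by (simp only: det_transpose)
  ultimately have "x \<in> integer_points"
    using integral_solution_of_unimodular by blast
  moreover obtain i where "t = g i"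
    using t B(1) g(1) by (auto simp: bij_betw_def)
  ultimately show ?thesis
    using t by (auto simp: integer_points_def x_def c'_def dest: spec[of _ i])
qed

text \<open>The inner products of \<open>u\<close> with the rows of a unimodular matrix are the
  entries of its product with \<open>u\<close>. This serves the vertices of the polar, where the
  products with the tight vectors are all \<open>1\<close>.\<close>

lemma dual_integral:
  assumes B: "B \<subseteq> S" "span B = UNIV" and u: "\<And>b. b \<in> B \<Longrightarrow> u \<bullet> b \<in> \<int>"
  shows "u \<in> integer_points"
proof -
  obtain B' where B': "B' \<subseteq> B" "independent B'" "B \<subseteq> span B'"
    using maximal_independent_subset by metis
  then have "span B' = UNIV"
    using B(2) by (metis span_mono span_span top.extremum_uniqueI)
  then obtain g :: "'r \<Rightarrow> real ^ 'r" where g: "bij_betw g UNIV B'"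
    "\<And>i j. (\<chi> i. g i) $ i $ j \<in> \<int>" "det (\<chi> i. g i) \<in> {-1, 1}"
    using unimodular_basis B' B(1) by (metis subset_trans)
  have "((\<chi> i. g i) *v u) $ i = u \<bullet> g i" for i
    by (simp add: matrix_vector_mul_component inner_commute)
  moreover have "g i \<in> B" for i
    using g(1) B'(1) by (auto simp: bij_betw_def)
  ultimately have "(\<chi> i. g i) *v u \<in> integer_points"
    using u by (simp add: integer_points_def)
  then show ?thesis
    using integral_solution_of_unimodular g(2,3) by blast
qed

lemma integer_point_of_subhull:
  assumes W: "W \<subseteq> S" and x: "x \<in> convex hull W" "x \<in> integer_points" "x \<noteq> 0"
  shows "x \<in> W"
proof -
  have "Finite_Set.finite W"
    using W finite finite_subset by blast
  then obtain T c where T: "T \<subseteq> W" "independent T" "\<And>t. t \<in> T \<Longrightarrow> 0 < c t" "sum c T \<le> (1::real)"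
    "x = (\<Sum>t\<in>T. c t *\<^sub>R t)"
    using convex_hull_combination_of_independent[OF _ x(1)] by blast
  have finT: "Finite_Set.finite T"
    using T(1) \<open>Finite_Set.finite W\<close> finite_subset by blast
  have ge1: "1 \<le> c t" if "t \<in> T" for t
  proof -
    have "c t \<in> \<int>"
      using coordinates_integral[of T c t] T W x(2) that by auto
    then show ?thesis
      using T(3)[OF that] by (auto elim!: Ints_cases)
  qed
  have "T \<noteq> {}"
    using T(5) x(3) by auto
  then obtain t where t: "t \<in> T"
    by blast
  \<comment> \<open>One coefficient already uses up the total \<open>1\<close>; any others would be
    positive with sum at most zero, so there are none.\<close>
  have "sum c (T - {t}) \<le> 0"
    using T(4) ge1[OF t] t finT by (simp add: sum_diff1)
  moreover have "T - {t} = {} \<or> 0 < sum c (T - {t})"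
    using T(3) finT by (metis DiffD1 finite_Diff sum_pos)
  ultimately have "T = {t}"
    using t by auto
  then have "c t = 1" "x = c t *\<^sub>R t"
    using T(4,5) ge1[OF t] by auto
  then show ?thesis
    using T(1) t by auto
qed

section \<open>The origin, vertices and integer points of the hull\<close>

lemma uminus_hull: "uminus ` (convex hull S) = convex hull S"
proof -
  have "uminus ` S = S"
    using uminus_closed by force
  then show ?thesis
    by (metis convex_hull_linear_image linear_uminus)
qed

lemma nonzero_element: obtains s where "s \<in> S" "s \<noteq> 0"
proof -
  have "\<not> S \<subseteq> {0}"
  proof
    assume "S \<subseteq> {0}"
    then have "(1 :: real ^ 'r) \<in> span {0}"
      using span_mono[of S "{0}"] spanning by blast
    then show False
      by simp
  qed
  then show thesis
    using that by blast
qed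

lemma zero_in_hull: "0 \<in> convex hull S"
proof -
  obtain s where "s \<in> S"
    using nonzero_element by blast
  then have "s \<in> convex hull S" "- s \<in> convex hull S"
    using uminus_closed by (auto intro: hull_inc)
  then show ?thesis
    using convexD[OF convex_convex_hull, of s S "- s" "1 / 2" "1 / 2"] by simp
qed

lemma aff_dim_hull: "aff_dim (convex hull S) = int CARD('r)"
proof -
  have "span (convex hull S) = UNIV"
    using spanning span_mono[OF hull_subset[of S convex]] by blast
  then have "dim (convex hull S) = CARD('r)"
    by (metis dim_span dim_vec_eq vec_dim_card)
  then show ?thesis
    using aff_dim_zero[of "convex hull S"] zero_in_hull hull_inc by metis
qed

text \<open>Full dimension gives some interior point; by symmetry its negative is interior as well,
  and the origin is their midpoint.\<close>

lemma zero_in_interior_hull: "0 \<in> interior (convex hull S)"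
proof -
  have "interior (convex hull S) \<noteq> {}"
    using aff_dim_hull by (simp add: interior_rel_interior_gen rel_interior_eq_empty)
      (use nonzero_element in blast)
  then obtain x where x: "x \<in> interior (convex hull S)"
    by blast
  then have "- x \<in> interior (convex hull S)"
    using interior_negations[of "convex hull S"] uminus_hull by auto
  then show ?thesis
    using x convexD[OF convex_interior[OF convex_convex_hull], of x S "- x" "1 / 2" "1 / 2"] by simp
qed

lemma vertices_hull: "polytope_vertices (convex hull S) = S - {0}"
proof (intro equalityI subsetI)
  fix v assume v: "v \<in> polytope_vertices (convex hull S)"
  then have "v \<in> S"
    by (simp add: polytope_vertices_def extreme_point_of_convex_hull)
  moreover have "v \<noteq> 0"
    using v zero_in_interior_hull extreme_point_not_in_interior
    by (fastforce simp: polytope_vertices_def)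
  ultimately show "v \<in> S - {0}"
    by simp
next
  let ?V = "{v. v extreme_point_of convex hull S}"
  fix v assume v: "v \<in> S - {0}"
  \<comment> \<open>The extreme points generate the hull, so a nonzero \<open>v\<close> of
    \<open>S\<close> is an integer point in the hull of a subset of \<open>S\<close> and therefore
    belongs to that subset.\<close>
  have "convex hull S = convex hull ?V"
    by (rule Krein_Milman_Minkowski) (auto simp: finite_imp_compact_convex_hull finite)
  then have "v \<in> convex hull ?V"
    using v hull_inc[of v S convex] by auto
  then show "v \<in> polytope_vertices (convex hull S)"
    using integer_point_of_subhull[of ?V v] v integral extreme_points_of_convex_hull[of S]
    by (auto simp: polytope_vertices_def)
qed

lemma terminal_hull: "terminal_polytope (convex hull S)"
  unfolding terminal_polytope_def vertices_hull
proof (intro equalityI subsetI)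
  fix x assume "x \<in> convex hull S \<inter> integer_points"
  then show "x \<in> insert 0 (S - {0})"
    using integer_point_of_subhull[of S x] by auto
next
  fix x assume "x \<in> insert 0 (S - {0})"
  then show "x \<in> convex hull S \<inter> integer_points"
    using zero_in_hull integral hull_inc[of x S convex] by (auto simp: integer_points_def)
qed

section \<open>The polar polytope\<close>

lemma polar_hull: "polar_dual (convex hull S) = {u. \<forall>s\<in>S. u \<bullet> s \<le> 1}"
proof -
  have "\<forall>x\<in>convex hull S. u \<bullet> x \<le> 1" if "\<forall>s\<in>S. u \<bullet> s \<le> 1" for u
  proof -
    have "convex hull S \<subseteq> {x. u \<bullet> x \<le> 1}"
      using that by (intro hull_minimal) (auto simp: convex_halfspace_le)
    then show ?thesis
      by blast
  qed
  then show ?thesis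
    by (auto simp: polar_dual_def hull_inc)
qed

lemma polyhedron_polar_hull: "polyhedron (polar_dual (convex hull S))"
proof -
  have "polar_dual (convex hull S) = \<Inter> ((\<lambda>s. {u. s \<bullet> u \<le> 1}) ` S)"
    by (auto simp: polar_hull inner_commute)
  then show ?thesis
    using finite polyhedron_halfspace_le by (auto intro!: polyhedron_Inter)
qed

text \<open>The hull contains a ball of radius \<open>e\<close> about the origin. Testing a nonzero
  \<open>u\<close> of the polar against its own multiple of norm \<open>e\<close> bounds its norm by
  \<open>1 / e\<close>.\<close>

lemma bounded_polar_hull: "bounded (polar_dual (convex hull S))"
proof -
  obtain e where e: "0 < e" "cball 0 e \<subseteq> convex hull S"
    using zero_in_interior_hull by (auto simp: mem_interior_cball)
  have "norm u \<le> 1 / e" if u: "u \<in> polar_dual (convex hull S)" for u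
  proof (cases "u = 0")
    case False
    have "(e / norm u) *\<^sub>R u \<in> convex hull S"
      using e False by (intro subsetD[OF e(2)]) simp
    then have "u \<bullet> ((e / norm u) *\<^sub>R u) \<le> 1"
      using u unfolding polar_dual_def by blast
    then have "e * norm u \<le> 1"
      using False by (simp add: dot_square_norm power2_eq_square)
    then show ?thesis
      using e(1) by (simp add: field_simps)
  qed (use e in simp)
  then show ?thesis
    by (auto simp: bounded_iff)
qed

text \<open>The polar is the hull of its extreme points, finitely many because it is a polyhedron.
  At each of them the tight vectors of \<open>S\<close> span, so \<open>dual_integral\<close>
  applies.\<close>

lemma lattice_polytope_polar_hull: "lattice_polytope (polar_dual (convex hull S))"
proof -
  let ?Q = "polar_dual (convex hull S)"
  have "compact ?Q" "convex ?Q"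
    using polyhedron_polar_hull bounded_polar_hull
    by (auto simp: compact_eq_bounded_closed polyhedron_imp_closed polyhedron_imp_convex)
  then have "?Q = convex hull {u. u extreme_point_of ?Q}"
    by (rule Krein_Milman_Minkowski)
  moreover have "u \<in> integer_points" if "u extreme_point_of ?Q" for u
    using dual_integral[of "{s \<in> S. u \<bullet> s = 1}" u]
      extreme_point_of_polar_tight_span[OF finite, of u] that by (auto simp: polar_hull)
  ultimately show ?thesis
    unfolding lattice_polytope_def
    using finite_polyhedron_extreme_points[OF polyhedron_polar_hull] by blast
qed

lemma reflexive_hull: "reflexive_polytope (convex hull S)"
  unfolding reflexive_polytope_def
  using aff_dim_hull zero_in_interior_hull lattice_polytope_polar_hull finite integral
  by (auto simp: lattice_polytope_def[of "convex hull S"])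

text \<open>\<open>k\<close> is the coordinate of \<open>v\<close> with respect to \<open>w\<close>,
  and \<open>1 / k\<close> that of \<open>w\<close> with respect to \<open>v\<close>. Both are
  integers, so \<open>k\<close> is a unit.\<close>

lemma parallel_imp_eq_or_minus:
  assumes "v \<in> S" "v = k *\<^sub>R w" "w \<in> S" "v \<noteq> 0"
  shows "v = w \<or> v = - w"
proof -
  have "w \<noteq> 0" "k \<noteq> 0"
    using assms by auto
  have "k \<in> \<int>"
    using coordinates_integral[of "{w}" "\<lambda>_. k" w] assms integral \<open>w \<noteq> 0\<close> by auto
  moreover have "1 / k \<in> \<int>"
    using coordinates_integral[of "{v}" "\<lambda>_. 1 / k" v] assms integral \<open>k \<noteq> 0\<close> by auto
  ultimately have "\<bar>k\<bar> \<ge> 1" "\<bar>1 / k\<bar> \<ge> 1"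
    using Ints_nonzero_abs_ge1[of k] Ints_nonzero_abs_ge1[of "1 / k"] \<open>k \<noteq> 0\<close> by simp_all
  then have "\<bar>k\<bar> = 1"
    by (simp add: abs_divide divide_simps split: if_splits)
  then show ?thesis
    using assms(2) by (auto simp: abs_if split: if_splits)
qed

end

section \<open>The columns of the symmetrised matrix\<close>

lemma eq_minus_self_iff: "v = - v \<longleftrightarrow> v = 0" for v :: "'v::real_vector"
proof
  assume "v = - v"
  then have "2 *\<^sub>R v = 0"
    by (metis scaleR_2 add.right_inverse)
  then show "v = 0"
    by simp
qed simp

lemma column_sym_matrix_Inl [simp]:
  "column (Inl k) (real_matrix (sym_matrix M)) = column k (real_matrix M)"
  by (simp add: column_def sym_matrix_def map_matrix_def vec_eq_iff)

lemma column_sym_matrix_Inr [simp]: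
  "column (Inr k) (real_matrix (sym_matrix M)) = - column k (real_matrix M)"
  by (simp add: column_def sym_matrix_def map_matrix_def vec_eq_iff)

lemma columns_sym_matrix:
  "columns (real_matrix (sym_matrix M)) =
    range (\<lambda>k. column k (real_matrix M)) \<union> range (\<lambda>k. - column k (real_matrix M))"
proof -
  have "columns (real_matrix (sym_matrix M)) =
      range (\<lambda>j. column j (real_matrix (sym_matrix M)))"
    by (auto simp: columns_def)
  then show ?thesis
    by (simp add: UNIV_sum image_Un image_image del: Un_UNIV_left)
qed

lemma det_of_int:
  fixes A :: "int ^ 'r::finite ^ 'r"
  shows "det (\<chi> i j. real_of_int (A $ i $ j)) = real_of_int (det A)"
  by (simp add: det_def)

text \<open>Weak unimodularity speaks of distinct column indices; a repeated index produces two
  equal rows here and hence determinant \<open>0\<close>.\<close>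

lemma det_columns_weakly_unimodular:
  fixes M :: "int ^ 'n::finite ^ 'r::finite"
  assumes "full_rank_weakly_unimodular M"
  shows "det (\<chi> i. column (f i) (real_matrix M)) \<in> {-1, 0, 1}"
proof (cases "inj f")
  case True
  have "(\<chi> i. column (f i) (real_matrix M)) =
      transpose (\<chi> i j. real_of_int ((\<chi> i j. M $ i $ f j) $ i $ j))"
    by (simp add: vec_eq_iff transpose_def column_def map_matrix_def)
  then have "det (\<chi> i. column (f i) (real_matrix M)) = real_of_int (det (\<chi> i j. M $ i $ f j))"
    by (simp only: det_transpose det_of_int)
  moreover have "det (\<chi> i j. M $ i $ f j) \<in> {-1, 0, 1}"
    using assms True by (simp add: full_rank_weakly_unimodular_def)
  ultimately show ?thesis
    by auto
next
  case False
  then obtain i j where "i \<noteq> j" "f i = f j"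
    by (auto simp: inj_def)
  then have "det (\<chi> i. column (f i) (real_matrix M)) = 0"
    by (intro det_identical_rows[of i j]) (auto simp: row_def)
  then show ?thesis
    by simp
qed

lemma unimodular_system_columns:
  fixes M :: "int ^ 'n::finite ^ 'r::finite"
  assumes M: "full_rank_weakly_unimodular M"
  shows "unimodular_system (columns (real_matrix (sym_matrix M)))"
proof
  let ?c = "\<lambda>k. column k (real_matrix M)"
  let ?S = "columns (real_matrix (sym_matrix M))"
  show "finite ?S"
    by (simp add: columns_sym_matrix)
  show "?S \<subseteq> integer_points"
    unfolding columns_sym_matrix by (auto simp: integer_points_def column_def map_matrix_def)
  show "- s \<in> ?S" if "s \<in> ?S" for s
    using that by (auto simp: columns_sym_matrix)
  have "dim (columns (real_matrix M)) = CARD('r)"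
    using M by (simp add: full_rank_weakly_unimodular_def column_rank_def)
  then have "span (columns (real_matrix M)) = UNIV"
    using dim_eq_full[of "columns (real_matrix M)"] by simp
  moreover have "columns (real_matrix M) \<subseteq> ?S"
    unfolding columns_sym_matrix by (auto simp: columns_def)
  ultimately show "span ?S = UNIV"
    using span_mono by blast
  show "det (\<chi> i. g i) \<in> {-1, 0, 1}" if g: "range g \<subseteq> ?S" for g :: "'r \<Rightarrow> real ^ 'r"
  proof -
    \<comment> \<open>The signs come out of the determinant row by row, with product of modulus
      \<open>1\<close>. The resulting \<open>f\<close> may fail to be injective even for injective
      \<open>g\<close>, which can pick a column together with its negative.\<close>
    have "\<exists>a k. a \<in> {-1, 1::real} \<and> g i = a *s ?c k" for i
    proof -
      have "g i \<in> ?S"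
        using g by blast
      then consider k where "g i = ?c k" | k where "g i = - ?c k"
        by (auto simp: columns_sym_matrix)
      then show ?thesis
        by cases (metis insertI1 insertI2 vector_smult_lid, metis insertI1 vector_sneg_minus1)
    qed
    then obtain a f where a: "\<And>i. a i \<in> {-1, 1::real}" and "\<And>i. g i = a i *s ?c (f i)"
      by metis
    then have "det (\<chi> i. g i) = prod a UNIV * det (\<chi> i. ?c (f i))"
      by (simp add: det_rows_mul)
    moreover have "\<bar>prod a UNIV\<bar> = 1"
    proof -
      have "\<bar>a i\<bar> = 1" for i
        using a[of i] by auto
      then show ?thesis
        by (simp add: abs_prod)
    qed
    then have "prod a UNIV = 1 \<or> prod a UNIV = -1"
      by linarith
    ultimately show ?thesis
      using det_columns_weakly_unimodular[OF M, of f] by auto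
  qed
qed

lemma independent_pair_iff:
  fixes a b :: "'v::real_vector"
  assumes "a \<noteq> b"
  shows "independent {a, b} \<longleftrightarrow> b \<noteq> 0 \<and> (\<forall>k. a \<noteq> k *\<^sub>R b)"
proof -
  have "independent {a, b} \<longleftrightarrow> b \<noteq> 0 \<and> a \<notin> span {b}"
    using assms by (simp add: independent_insert)
  then show ?thesis
    unfolding span_singleton by blast
qed

lemma singleton_column_indep: "{k} \<in> column_indep M \<longleftrightarrow> column k (real_matrix M) \<noteq> 0"
  by (simp add: column_indep_def)

text \<open>By \<open>parallel_imp_eq_or_minus\<close> the only proportional nonzero columns are
  equal or antipodal ones. Parallelism in the matroid thus becomes equality up to sign, the form in
  which \<open>card_flat_atoms\<close> takes it.\<close>

lemma pair_column_indep:
  assumes M: "full_rank_weakly_unimodular M" and "k \<noteq> l"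
  shows "{k, l} \<in> column_indep M \<longleftrightarrow>
    column k (real_matrix M) \<noteq> 0 \<and> column l (real_matrix M) \<noteq> 0 \<and>
    column k (real_matrix M) \<noteq> column l (real_matrix M) \<and>
    column k (real_matrix M) \<noteq> - column l (real_matrix M)" (is "_ \<longleftrightarrow> ?R")
proof -
  interpret unimodular_system "columns (real_matrix (sym_matrix M))"
    using M by (rule unimodular_system_columns)
  let ?c = "\<lambda>k. column k (real_matrix M)"
  have "{k, l} \<in> column_indep M \<longleftrightarrow> ?c k \<noteq> ?c l \<and> ?c l \<noteq> 0 \<and> (\<forall>a. ?c k \<noteq> a *\<^sub>R ?c l)"
    using \<open>k \<noteq> l\<close> independent_pair_iff[of "?c k" "?c l"] by (auto simp: column_indep_def)
  also have "\<dots> \<longleftrightarrow> ?R"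
  proof
    assume *: "?c k \<noteq> ?c l \<and> ?c l \<noteq> 0 \<and> (\<forall>a. ?c k \<noteq> a *\<^sub>R ?c l)"
    \<comment> \<open>The multiple \<open>0\<close> excludes a zero column, the multiple
      \<open>-1\<close> an antipodal one.\<close>
    then have "?c k \<noteq> 0 *\<^sub>R ?c l" "?c k \<noteq> (-1) *\<^sub>R ?c l"
      by blast+
    then show ?R
      using * by simp
  next
    assume ?R
    then show "?c k \<noteq> ?c l \<and> ?c l \<noteq> 0 \<and> (\<forall>a. ?c k \<noteq> a *\<^sub>R ?c l)"
      using parallel_imp_eq_or_minus[of "?c k" _ "?c l"] unfolding columns_sym_matrix by blast
  qed
  finally show ?thesis .
qed

section \<open>Matroid rank and the atoms of the lattice of flats\<close>

context matroid
begin

lemma finite_indep_subsets: "finite {Y \<in> I. Y \<subseteq> X}"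
  by (rule finite_subset[of _ "Pow E"]) (auto simp: finite_ground dest: indep_subset_ground)

lemma card_le_matroid_rank: "Y \<in> I \<Longrightarrow> Y \<subseteq> X \<Longrightarrow> card Y \<le> matroid_rank I X"
  unfolding matroid_rank_def using finite_indep_subsets by (intro Max_ge) auto

lemma matroid_rank_attained: obtains Y where "Y \<in> I" "Y \<subseteq> X" "card Y = matroid_rank I X"
proof -
  have "matroid_rank I X \<in> card ` {Y \<in> I. Y \<subseteq> X}"
    unfolding matroid_rank_def using finite_indep_subsets indep_empty by (intro Max_in) auto
  then show thesis
    using that by auto
qed

lemma le_matroid_rank_iff: "n \<le> matroid_rank I X \<longleftrightarrow> (\<exists>Y\<in>I. Y \<subseteq> X \<and> card Y = n)"
proof
  assume n: "n \<le> matroid_rank I X"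
  obtain Y where Y: "Y \<in> I" "Y \<subseteq> X" "card Y = matroid_rank I X"
    by (rule matroid_rank_attained)
  then obtain Z where "Z \<subseteq> Y" "card Z = n"
    using n obtain_subset_with_card_n by metis
  then show "\<exists>Y\<in>I. Y \<subseteq> X \<and> card Y = n"
    using Y indep_mono by blast
qed (use card_le_matroid_rank in blast)

lemma matroid_rank_ge_1_iff: "1 \<le> matroid_rank I X \<longleftrightarrow> (\<exists>a\<in>X. {a} \<in> I)"
  unfolding le_matroid_rank_iff by (auto simp: card_1_singleton_iff)

text \<open>Together with \<open>matroid_rank_ge_1_iff\<close> this reduces questions about atoms to
  independent singletons and pairs.\<close>

lemma matroid_rank_ge_2_iff:
  "2 \<le> matroid_rank I X \<longleftrightarrow> (\<exists>a\<in>X. \<exists>b\<in>X. a \<noteq> b \<and> {a, b} \<in> I)"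
proof
  assume "2 \<le> matroid_rank I X"
  then show "\<exists>a\<in>X. \<exists>b\<in>X. a \<noteq> b \<and> {a, b} \<in> I"
    unfolding le_matroid_rank_iff by (auto simp: card_2_iff)
next
  assume "\<exists>a\<in>X. \<exists>b\<in>X. a \<noteq> b \<and> {a, b} \<in> I"
  then obtain a b where "{a, b} \<subseteq> X" "a \<noteq> b" "{a, b} \<in> I"
    by blast
  then show "2 \<le> matroid_rank I X"
    using card_le_matroid_rank[of "{a, b}" X] by simp
qed

text \<open>
  The hypotheses say that two elements are parallel exactly when their vectors agree up to sign, so
  the atom through a vector \<open>w\<close> consists of the elements mapped to \<open>0\<close>, \<open>w\<close> or \<open>-w\<close>.
\<close>

lemma card_flat_atoms:
  fixes v :: "'a \<Rightarrow> 'v::real_vector"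
  assumes one: "\<And>a. a \<in> E \<Longrightarrow> {a} \<in> I \<longleftrightarrow> v a \<noteq> 0"
    and two: "\<And>a b. a \<in> E \<Longrightarrow> b \<in> E \<Longrightarrow> a \<noteq> b \<Longrightarrow>
      {a, b} \<in> I \<longleftrightarrow> v a \<noteq> 0 \<and> v b \<noteq> 0 \<and> v a \<noteq> v b \<and> v a \<noteq> - v b"
  shows "card (v ` E \<union> (\<lambda>a. - v a) ` E - {0}) = 2 * card (flat_atoms E I)"
proof -
  define V where "V = v ` E \<union> (\<lambda>a. - v a) ` E - {0}"
  define G where "G w = {a \<in> E. v a \<in> {0, w, - w}}" for w
  \<comment> \<open>Vectors among \<open>0\<close>, \<open>w\<close> and \<open>- w\<close> are
    zero, equal or antipodal in pairs, so \<open>G w\<close> contains no independent pair.\<close>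
  have G_le: "\<not> 2 \<le> matroid_rank I (G w)" for w
    unfolding matroid_rank_ge_2_iff using two by (auto simp: G_def)
  have sub: "X \<subseteq> Y \<Longrightarrow> 2 \<le> matroid_rank I X \<Longrightarrow> 2 \<le> matroid_rank I Y" for X Y
    unfolding matroid_rank_ge_2_iff by blast
  have "flat_atoms E I = G ` V"
  proof (intro equalityI subsetI)
    fix F assume "F \<in> flat_atoms E I"
    then have F: "F \<subseteq> E" "\<And>x. x \<in> E - F \<Longrightarrow> 2 \<le> matroid_rank I (insert x F)" "matroid_rank I F = 1"
      by (auto simp: flat_atoms_def flat_def Suc_le_eq numeral_2_eq_2)
    then obtain a where a: "a \<in> F" "{a} \<in> I"
      using matroid_rank_ge_1_iff[of F] by auto
    have nz: "v a \<noteq> 0"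
      using a F(1) one by blast
    have "F \<subseteq> G (v a)"
    proof
      fix b assume b: "b \<in> F"
      have "\<not> (a \<noteq> b \<and> {a, b} \<in> I)"
        using F(3) matroid_rank_ge_2_iff[of F] a(1) b by auto
      then have "v b = 0 \<or> v a = v b \<or> v a = - v b"
        using two[of a b] a(1) b F(1) nz by blast
      then show "b \<in> G (v a)"
        using b F(1) by (auto simp: G_def)
    qed
    \<comment> \<open>An element outside the flat \<open>F\<close> would raise the rank to
      \<open>2\<close> while staying inside \<open>G (v a)\<close>, where the rank is at most
      \<open>1\<close>.\<close>
    moreover have "x \<in> F" if "x \<in> G (v a)" for x
    proof (rule ccontr)
      assume "x \<notin> F"
      then have "2 \<le> matroid_rank I (insert x F)"
        using F(2) that by (auto simp: G_def)
      then show False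
        using sub[of "insert x F" "G (v a)"] G_le that calculation by blast
    qed
    ultimately have "F = G (v a)"
      by blast
    moreover have "v a \<in> V"
      using a F(1) nz by (auto simp: V_def)
    ultimately show "F \<in> G ` V"
      by blast
  next
    fix F assume "F \<in> G ` V"
    then obtain w where w: "w \<in> V" "F = G w"
      by blast
    then obtain a where a: "a \<in> E" "v a = w \<or> v a = - w" "w \<noteq> 0"
      by (auto simp: V_def)
    then have "a \<in> G w" "{a} \<in> I"
      using one by (auto simp: G_def)
    then have "1 \<le> matroid_rank I (G w)"
      unfolding matroid_rank_ge_1_iff by blast
    then have rank: "matroid_rank I (G w) = 1"
      using G_le[of w] by linarith
    moreover have "2 \<le> matroid_rank I (insert x (G w))" if x: "x \<in> E - G w" for x
    proof -
      have "v x \<noteq> 0" "v x \<noteq> w" "v x \<noteq> - w"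
        using x by (auto simp: G_def)
      moreover have "x \<noteq> a"
        using x \<open>a \<in> G w\<close> by blast
      ultimately have "{x, a} \<in> I" "x \<noteq> a"
        using two[of x a] a x by auto
      then show ?thesis
        unfolding matroid_rank_ge_2_iff using \<open>a \<in> G w\<close> by blast
    qed
    ultimately show "F \<in> flat_atoms E I"
      using w(2) by (fastforce simp: flat_atoms_def flat_def G_def)
  qed
  moreover have "finite V"
    by (simp add: V_def finite_ground)
  \<comment> \<open>\<open>G\<close> is two-to-one on \<open>V\<close>: a non-loop \<open>a\<close>
    in the atom determines the vector up to sign.\<close>
  have "card {w' \<in> V. G w' = G w} = 2" if w: "w \<in> V" for w
  proof -
    obtain a where a: "a \<in> E" "v a = w \<or> v a = - w" "w \<noteq> 0"
      using w by (auto simp: V_def)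
    have "w' = w \<or> w' = - w" if "w' \<in> V" "G w' = G w" for w'
    proof -
      have "a \<in> G w'"
        using a that(2) by (auto simp: G_def)
      then show ?thesis
        using a by (auto simp: G_def)
    qed
    moreover have "- w \<in> V" "G (- w) = G w"
      using w by (auto simp: V_def G_def)
    ultimately have "{w' \<in> V. G w' = G w} = {w, - w}"
      using w by auto
    moreover have "w \<noteq> - w"
      using a(3) by (simp add: eq_minus_self_iff)
    ultimately show ?thesis
      by simp
  qed
  then have "(\<Sum>F\<in>G ` V. card {w \<in> V. G w = F}) = (\<Sum>F\<in>G ` V. 2)"
    by (intro sum.cong) auto
  then have "card V = 2 * card (G ` V)"
    using sum.image_gen[OF \<open>finite V\<close>, of "\<lambda>_. 1 :: nat" G] by simp
  ultimately show ?thesis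
    by (simp add: V_def)
qed

end

section \<open>Transfer to the represented matroid\<close>

theorem theorem4p3:
  fixes E :: "'a set" and I :: "'a set set" and M :: "int ^ 'n::finite ^ 'r::finite"
  assumes "regular_matroid TYPE('r) TYPE('n) E I"
    and "matroid_rank I E = CARD('r)"
    and "card E = CARD('n)"
    and "full_rank_weakly_unimodular M"
    and "represents M E I"
  shows "centrally_symmetric (sym_edge_polytope M)
    \<and> aff_dim (sym_edge_polytope M) = int (matroid_rank I E)
    \<and> reflexive_polytope (sym_edge_polytope M)
    \<and> terminal_polytope (sym_edge_polytope M)
    \<and> card (polytope_vertices (sym_edge_polytope M)) = 2 * card (flat_atoms E I)
    \<and> (simple_matroid E I \<longrightarrow>
         bij_betw (\<lambda>j. column j (real_matrix (sym_matrix M))) UNIV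
           (polytope_vertices (sym_edge_polytope M))
         \<and> (\<forall>\<phi>. matroid_isomorphism \<phi> E I UNIV (column_indep M) \<longrightarrow>
              bij_betw (\<lambda>e. {column (\<phi> e) (real_matrix M), - column (\<phi> e) (real_matrix M)}) E
                {{v, - v} |v. v \<in> polytope_vertices (sym_edge_polytope M)}))"
proof -
  interpret matroid E I
    using assms(1) by (simp add: regular_matroid_def)
  let ?c = "\<lambda>k. column k (real_matrix M)"
  let ?S = "columns (real_matrix (sym_matrix M))"
  interpret U: unimodular_system ?S
    using assms(4) by (rule unimodular_system_columns)
  have V: "polytope_vertices (sym_edge_polytope M) = range ?c \<union> range (\<lambda>k. - ?c k) - {0}"
    using U.vertices_hull by (simp add: sym_edge_polytope_def columns_sym_matrix)
  have one: "{a} \<in> I \<longleftrightarrow> ?c (\<phi> a) \<noteq> 0"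
    if "matroid_isomorphism \<phi> E I UNIV (column_indep M)" "a \<in> E" for \<phi> a
    using that singleton_column_indep[of "\<phi> a" M] by (simp add: matroid_isomorphism_def)
  have two: "{a, b} \<in> I \<longleftrightarrow>
      ?c (\<phi> a) \<noteq> 0 \<and> ?c (\<phi> b) \<noteq> 0 \<and> ?c (\<phi> a) \<noteq> ?c (\<phi> b) \<and> ?c (\<phi> a) \<noteq> - ?c (\<phi> b)"
    if iso: "matroid_isomorphism \<phi> E I UNIV (column_indep M)" and ab: "a \<in> E" "b \<in> E" "a \<noteq> b"
    for \<phi> a b
  proof -
    have "\<phi> a \<noteq> \<phi> b"
      using iso ab by (auto simp: matroid_isomorphism_def bij_betw_def inj_on_def)
    moreover have "{a, b} \<in> I \<longleftrightarrow> {\<phi> a, \<phi> b} \<in> column_indep M"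
      using iso ab by (simp add: matroid_isomorphism_def)
    ultimately show ?thesis
      using pair_column_indep[OF assms(4)] by simp
  qed
  obtain \<phi> where \<phi>: "matroid_isomorphism \<phi> E I UNIV (column_indep M)"
    using assms(5) by (auto simp: represents_def)
  then have \<phi>E: "\<phi> ` E = UNIV"
    by (simp add: matroid_isomorphism_def bij_betw_def)
  \<comment> \<open>Reindexing the columns by \<open>E\<close> gives the vertex set the shape that
    \<open>card_flat_atoms\<close> counts.\<close>
  have "range ?c = (\<lambda>a. ?c (\<phi> a)) ` E" "range (\<lambda>k. - ?c k) = (\<lambda>a. - ?c (\<phi> a)) ` E"
    unfolding \<phi>E[symmetric] by (simp_all add: image_image)
  then have card: "card (polytope_vertices (sym_edge_polytope M)) = 2 * card (flat_atoms E I)"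
    unfolding V using card_flat_atoms[OF one[OF \<phi>] two[OF \<phi>]] by simp
  have simple: "bij_betw (\<lambda>j. column j (real_matrix (sym_matrix M))) UNIV
           (polytope_vertices (sym_edge_polytope M)) \<and>
      (\<forall>\<psi>. matroid_isomorphism \<psi> E I UNIV (column_indep M) \<longrightarrow>
        bij_betw (\<lambda>e. {?c (\<psi> e), - ?c (\<psi> e)}) E
          {{v, - v} |v. v \<in> polytope_vertices (sym_edge_polytope M)})"
    if "simple_matroid E I"
  proof -
    have singleton: "{a} \<in> I" if "a \<in> E" for a
      using that \<open>simple_matroid E I\<close> by (auto simp: simple_matroid_def matroid_loop_def)
    have pair: "{a, b} \<in> I" if "a \<in> E" "b \<in> E" "a \<noteq> b" for a b
      using that singleton \<open>simple_matroid E I\<close>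
      unfolding simple_matroid_def matroid_parallel_def by blast
    have nz: "?c k \<noteq> 0" for k
      using one[OF \<phi>] singleton \<phi>E by (metis imageE iso_tuple_UNIV_I)
    have ne: "?c k \<noteq> ?c l" "?c k \<noteq> - ?c l" if "k \<noteq> l" for k l
    proof -
      obtain a b where "a \<in> E" "b \<in> E" "k = \<phi> a" "l = \<phi> b"
        using \<phi>E by (metis imageE iso_tuple_UNIV_I)
      then show "?c k \<noteq> ?c l" "?c k \<noteq> - ?c l"
        using two[OF \<phi>, of a b] pair[of a b] that by auto
    qed
    \<comment> \<open>Equal indices are covered too, since only the zero vector is its own
      negative.\<close>
    have neg: "?c k \<noteq> - ?c l" for k l
      using ne(2)[of k l] nz[of k] by (cases "k = l") (auto simp: eq_minus_self_iff)
    have S: "polytope_vertices (sym_edge_polytope M) = range ?c \<union> range (\<lambda>k. - ?c k)"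
      unfolding V using nz by auto
    have "inj (\<lambda>j. column j (real_matrix (sym_matrix M)))"
    proof (rule injI)
      fix i j assume eq: "column i (real_matrix (sym_matrix M)) = column j (real_matrix (sym_matrix M))"
      show "i = j"
        using eq ne(1) neg neg[symmetric] by (cases i; cases j) auto
    qed
    moreover have "range (\<lambda>j. column j (real_matrix (sym_matrix M))) =
        polytope_vertices (sym_edge_polytope M)"
      unfolding S columns_sym_matrix[symmetric] by (auto simp: columns_def)
    moreover have "bij_betw (\<lambda>e. {?c (\<psi> e), - ?c (\<psi> e)}) E
        {{v, - v} |v. v \<in> polytope_vertices (sym_edge_polytope M)}"
      if \<psi>: "matroid_isomorphism \<psi> E I UNIV (column_indep M)" for \<psi>
    proof -
      have \<psi>E: "bij_betw \<psi> E UNIV"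
        using \<psi> by (simp add: matroid_isomorphism_def)
      \<comment> \<open>Two equal antipodal pairs match either directly or crosswise;
        \<open>neg\<close> excludes the crossed match.\<close>
      have "inj (\<lambda>k. {?c k, - ?c k})"
        using ne(1) neg by (intro injI) (metis doubleton_eq_iff)
      moreover have "range (\<lambda>k. {?c k, - ?c k}) =
          {{v, - v} |v. v \<in> polytope_vertices (sym_edge_polytope M)}"
        unfolding S by (auto simp: insert_commute)
      ultimately have "bij_betw (\<lambda>k. {?c k, - ?c k}) UNIV
          {{v, - v} |v. v \<in> polytope_vertices (sym_edge_polytope M)}"
        by (simp add: bij_betw_def)
      from bij_betw_trans[OF \<psi>E this] show ?thesis
        by (simp add: o_def)
    qed
    ultimately show ?thesis
      by (simp add: bij_betw_def)
  qed
  have "centrally_symmetric (sym_edge_polytope M)"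
    "aff_dim (sym_edge_polytope M) = int (matroid_rank I E)"
    "reflexive_polytope (sym_edge_polytope M)" "terminal_polytope (sym_edge_polytope M)"
    using U.uminus_hull U.aff_dim_hull U.reflexive_hull U.terminal_hull assms(2)
    by (simp_all add: sym_edge_polytope_def centrally_symmetric_def)
  then show ?thesis
    using card simple by blast
qed

end
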